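(* Let $G=(A,B,E)$ be a bipartite graph with a proper edge coloring $\chi:E\to\{1,\dots,d\}$. Then there exists a subgraph $G'=(A,B,E')$ of $G$ without a slow walk and with $|E'|>\frac{\log d}{480d}|E|$. Similarly, there exists a subgraph $G''=(A,B,E'')$ of $G$ without a fast walk and with $|E''|>\frac{\log d}{480d}|E|$. (Colors in the subgraphs are inherited from $\chi$.)
   Context: A bipartite graph is a triple $G=(A,B,E)$ with disjoint vertex sets $A,B$ and $E\subseteq A\times B$; it is simple. A proper edge coloring assigns colors so that adjacent edges get different colors. A walk of length $m$ is a sequence of vertices $v_0,\dots,v_m$ with $v_{i-1}v_i$ an edge for $1\le i\le m$ and $v_{i-2}\ne v_i$ for $2\le i\le m$; its coloring is $(\chi(v_0v_1),\dots,\chi(v_{m-1}v_m))$. A fast walk is a walk of length 4 (starting in either side) whose coloring $(c_1,c_2,c_3,c_4)$ satisfies $c_2<c_3<c_4\le c_1$. A slow walk is a walk of length 4 starting at a vertex $v_0\in B$ whose coloring satisfies $c_2<c_3<c_4$ and $c_2<c_1\le c_4$. $\log$ denotes the binary logarithm. *)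

theory Defs
  imports Complex_Main
begin

definition bipartite_graph :: "'v set \<Rightarrow> 'v set \<Rightarrow> ('v \<times> 'v) set \<Rightarrow> bool" where
  "bipartite_graph A B E \<longleftrightarrow> A \<inter> B = {} \<and> E \<subseteq> A \<times> B"

definition proper_edge_coloring :: "('v \<times> 'v) set \<Rightarrow> nat \<Rightarrow> ('v \<times> 'v \<Rightarrow> nat) \<Rightarrow> bool" where
  "proper_edge_coloring E d \<chi> \<longleftrightarrow>
     (\<forall>e\<in>E. \<chi> e \<in> {1..d}) \<and>
     (\<forall>e\<in>E. \<forall>f\<in>E. e \<noteq> f \<and> {fst e, snd e} \<inter> {fst f, snd f} \<noteq> {} \<longrightarrow> \<chi> e \<noteq> \<chi> f)"

(* Edges are stored as pairs oriented from A to B, but a walk traverses them in both directions. *)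
definition adjacent :: "('v \<times> 'v) set \<Rightarrow> 'v \<Rightarrow> 'v \<Rightarrow> bool" where
  "adjacent E u v \<longleftrightarrow> (u, v) \<in> E \<or> (v, u) \<in> E"

(* Meaningful only if u and v are adjacent; in a bipartite graph at most one of
   (u, v) and (v, u) is in E. *)
definition edge_color :: "('v \<times> 'v) set \<Rightarrow> ('v \<times> 'v \<Rightarrow> nat) \<Rightarrow> 'v \<Rightarrow> 'v \<Rightarrow> nat" where
  "edge_color E \<chi> u v = (if (u, v) \<in> E then \<chi> (u, v) else \<chi> (v, u))"

definition walk :: "'v set \<Rightarrow> 'v set \<Rightarrow> ('v \<times> 'v) set \<Rightarrow> nat \<Rightarrow> 'v list \<Rightarrow> bool" where
  "walk A B E m vs \<longleftrightarrow>
     length vs = m + 1 \<and> set vs \<subseteq> A \<union> B \<and>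
     (\<forall>i\<in>{1..m}. adjacent E (vs ! (i - 1)) (vs ! i)) \<and>
     (\<forall>i\<in>{2..m}. vs ! (i - 2) \<noteq> vs ! i)"

definition walk_coloring ::
  "('v \<times> 'v) set \<Rightarrow> ('v \<times> 'v \<Rightarrow> nat) \<Rightarrow> 'v list \<Rightarrow> nat list" where
  "walk_coloring E \<chi> vs = map (\<lambda>i. edge_color E \<chi> (vs ! (i - 1)) (vs ! i)) [1..<length vs]"

definition fast_walk ::
  "'v set \<Rightarrow> 'v set \<Rightarrow> ('v \<times> 'v) set \<Rightarrow> ('v \<times> 'v \<Rightarrow> nat) \<Rightarrow> 'v list \<Rightarrow> bool" where
  "fast_walk A B E \<chi> vs \<longleftrightarrow>
     walk A B E 4 vs \<and>
     (\<exists>c1 c2 c3 c4. walk_coloring E \<chi> vs = [c1, c2, c3, c4] \<and>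
        c2 < c3 \<and> c3 < c4 \<and> c4 \<le> c1)"

definition slow_walk ::
  "'v set \<Rightarrow> 'v set \<Rightarrow> ('v \<times> 'v) set \<Rightarrow> ('v \<times> 'v \<Rightarrow> nat) \<Rightarrow> 'v list \<Rightarrow> bool" where
  "slow_walk A B E \<chi> vs \<longleftrightarrow>
     walk A B E 4 vs \<and> vs ! 0 \<in> B \<and>
     (\<exists>c1 c2 c3 c4. walk_coloring E \<chi> vs = [c1, c2, c3, c4] \<and>
        c2 < c3 \<and> c3 < c4 \<and> c2 < c1 \<and> c1 \<le> c4)"

end

(* Let 2^K <= d < 2^(K+1).  Give every vertex v a random threshold m(v) in {0..<4d}.  An edge xy of
   color c has level s if m(x) - c lies in [8^s, 2*8^s) and m(y) - p(c) lies in [w, 2w) for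
   w = 2^K / 8^s; here p(c) = c against fast walks and p(c) = d - c against slow ones.  For fixed s this
   has probability 2^K / (4d)^2, so summing over the order of K/6 admissible levels gives each edge
   survival probability of order (log d) / d.  Deleting the edges that share a vertex with another
   edge of their own level costs at most half of them in expectation, because 4 * 8^s * w <= 4d.
   Afterwards the edges at a vertex have different levels.  At an A-vertex the two colors then differ
   by about 8^s with s the larger level, at a B-vertex by at most 2w with w taken at the smaller level.
   The admissible levels satisfy s >= (K-1)/6, which makes jumps at B smaller than jumps at A of the
   same or higher level; comparing the jumps along a forbidden walk gives a contradiction. *)
theory Submission
  imports Defs "HOL-Library.FuncSet"
begin

section \<open>Counting functions with prescribed values, and double counting\<close>

text \<open>Coordinates outside \<open>Z\<close> stay free and each \<open>z \<in> Z\<close>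
  contributes a factor \<open>card (T z)\<close>, so the constraints act as independent events. The
  identity is multiplied out to stay within \<open>nat\<close>.\<close>

lemma card_PiE_constrained:
  fixes S :: "'b set" and T :: "'a \<Rightarrow> 'b set"
  assumes "finite X" "Z \<subseteq> X" "finite S" "\<And>z. z \<in> Z \<Longrightarrow> T z \<subseteq> S"
  shows "card {f \<in> X \<rightarrow>\<^sub>E S. \<forall>z\<in>Z. f z \<in> T z} * card S ^ card Z
           = (\<Prod>z\<in>Z. card (T z)) * card (X \<rightarrow>\<^sub>E S)"
proof -
  have "{f \<in> X \<rightarrow>\<^sub>E S. \<forall>z\<in>Z. f z \<in> T z} = (\<Pi>\<^sub>E v\<in>X. if v \<in> Z then T v else S)"
    using assms(2,4) by (fastforce simp: PiE_iff split: if_splits)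
  hence "card {f \<in> X \<rightarrow>\<^sub>E S. \<forall>z\<in>Z. f z \<in> T z} = (\<Prod>v\<in>X. card (if v \<in> Z then T v else S))"
    using assms(1) by (simp add: card_PiE)
  also have "\<dots> = (\<Prod>v\<in>X - Z. card (if v \<in> Z then T v else S)) * (\<Prod>v\<in>Z. card (if v \<in> Z then T v else S))"
    by (rule prod.subset_diff) (use assms in auto)
  also have "\<dots> = card S ^ card (X - Z) * (\<Prod>z\<in>Z. card (T z))"
    by simp
  finally have *: "card {f \<in> X \<rightarrow>\<^sub>E S. \<forall>z\<in>Z. f z \<in> T z} = card S ^ card (X - Z) * (\<Prod>z\<in>Z. card (T z))" .
  have "card S ^ card (X - Z) * card S ^ card Z = card S ^ card X"
    using assms(1,2) by (metis card_Diff_subset card_mono diff_add finite_subset power_add)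
  thus ?thesis
    unfolding * using assms(1) by (simp add: card_PiE mult_ac)
qed

lemma card_PiE_one:
  assumes "finite X" "x \<in> X" "T \<subseteq> {..<M}"
  shows "real (card {f \<in> X \<rightarrow>\<^sub>E {..<M::nat}. f x \<in> T}) * M = card T * real (card (X \<rightarrow>\<^sub>E {..<M}))"
  using card_PiE_constrained[of X "{x}" "{..<M}" "\<lambda>_. T"] assms
  by (simp flip: of_nat_mult)

lemma card_PiE_two:
  assumes "finite X" "x \<in> X" "x' \<in> X" "x \<noteq> x'" "T \<subseteq> {..<M}" "T' \<subseteq> {..<M}"
  shows "real (card {f \<in> X \<rightarrow>\<^sub>E {..<M::nat}. f x \<in> T \<and> f x' \<in> T'}) * M^2
           = real (card T) * card T' * card (X \<rightarrow>\<^sub>E {..<M})"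
proof -
  have "(if z = x then T else T') \<subseteq> {..<M}" for z using assms by simp
  from card_PiE_constrained[of X "{x, x'}" "{..<M}" "\<lambda>z. if z = x then T else T'", OF _ _ _ this]
  have "card {f \<in> X \<rightarrow>\<^sub>E {..<M}. f x \<in> T \<and> f x' \<in> T'} * M^2
      = card T * card T' * card (X \<rightarrow>\<^sub>E {..<M})"
    using assms by (simp add: power2_eq_square)
  thus ?thesis by (simp flip: of_nat_mult of_nat_power)
qed

text \<open>Double counting. With \<open>\<Omega>\<close> read as a uniform probability space, it is
  linearity of expectation for the size of a random subset of \<open>E\<close>.\<close>

lemma sum_card_swap:
  assumes "finite \<Omega>" "finite E"
  shows "(\<Sum>\<omega>\<in>\<Omega>. real (card {e \<in> E. P \<omega> e})) = (\<Sum>e\<in>E. real (card {\<omega> \<in> \<Omega>. P \<omega> e}))"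
proof -
  have "real (card {e \<in> E. P \<omega> e}) = (\<Sum>e\<in>E. of_bool (P \<omega> e))" for \<omega>
    using assms by (simp add: Int_def)
  moreover have "real (card {\<omega> \<in> \<Omega>. P \<omega> e}) = (\<Sum>\<omega>\<in>\<Omega>. of_bool (P \<omega> e))" for e
    using assms by (simp add: Int_def)
  ultimately show ?thesis by (simp add: sum.swap[of _ E])
qed

section \<open>Windows and their overlaps\<close>

text \<open>The offset of a window from \<open>p\<close> equals its width, so membership fixes the
  distance to \<open>p\<close> up to a factor of 2.\<close>

definition window :: "nat \<Rightarrow> nat \<Rightarrow> nat set" where
  "window p w = {p + w..<p + 2 * w}"

lemma card_window [simp]: "card (window p w) = w"
  by (simp add: window_def)

lemma finite_window [simp]: "finite (window p w)"
  by (simp add: window_def)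

lemma window_subset: "p + 2 * w \<le> M \<Longrightarrow> window p w \<subseteq> {..<M}"
  by (auto simp: window_def)

text \<open>Exchange the order of counting: the first window has \<open>w\<close> points
  \<open>m\<close>, and each lies in the windows of at most \<open>w\<close> distinct starting
  values.\<close>

lemma sum_card_window_Int:
  assumes "finite F" "inj_on \<alpha> F"
  shows "(\<Sum>e\<in>F. card (window p w \<inter> window (\<alpha> e) w)) \<le> w * w"
proof -
  have "(\<Sum>e\<in>F. card (window p w \<inter> window (\<alpha> e) w))
      = (\<Sum>e\<in>F. card {m \<in> window p w. m \<in> window (\<alpha> e) w})"
    by (intro sum.cong refl arg_cong[where f = card]) auto
  also have "\<dots> = (\<Sum>m\<in>window p w. card {e \<in> F. m \<in> window (\<alpha> e) w})"
    using sum_card_swap[of F "window p w" "\<lambda>e m. m \<in> window (\<alpha> e) w"] assms(1)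
    unfolding of_nat_sum[symmetric] of_nat_eq_iff by simp
  also have "\<dots> \<le> (\<Sum>m\<in>window p w. w)"
  proof (rule sum_mono)
    fix m
    \<comment> \<open>Where truncated subtraction cuts off the lower end, the interval only gets
      shorter than \<open>w\<close>.\<close>
    have "\<alpha> ` {e \<in> F. m \<in> window (\<alpha> e) w} \<subseteq> {m + 1 - 2 * w..<m + 1 - w}"
      unfolding window_def by (intro image_subsetI) (simp; linarith)
    hence "card (\<alpha> ` {e \<in> F. m \<in> window (\<alpha> e) w}) \<le> card {m + 1 - 2 * w..<m + 1 - w}"
      by (intro card_mono) auto
    also have "\<dots> \<le> w" by simp
    finally show "card {e \<in> F. m \<in> window (\<alpha> e) w} \<le> w"
      using assms(2) by (subst (asm) card_image) (auto intro: inj_on_subset)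
  qed
  finally show ?thesis by simp
qed

section \<open>Random levels and the deletion of conflicting edges\<close>

text \<open>\<open>\<omega>\<close> is a pair of threshold functions, one per side of the graph.
  Keeping \<open>\<alpha>\<close> and \<open>\<beta>\<close> separate allows colors to be reflected
  on one side only.\<close>

definition level_edges ::
  "('a \<times> 'b) set \<Rightarrow> ('a \<times> 'b \<Rightarrow> nat) \<Rightarrow> ('a \<times> 'b \<Rightarrow> nat) \<Rightarrow> nat \<Rightarrow> nat
    \<Rightarrow> ('a \<Rightarrow> nat) \<times> ('b \<Rightarrow> nat) \<Rightarrow> ('a \<times> 'b) set" where
  "level_edges E \<alpha> \<beta> a b \<omega> =
     {e \<in> E. fst \<omega> (fst e) \<in> window (\<alpha> e) a \<and> snd \<omega> (snd e) \<in> window (\<beta> e) b}"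

definition isolated_edges :: "('a \<times> 'b) set \<Rightarrow> ('a \<times> 'b) set" where
  "isolated_edges H = {e \<in> H. \<forall>e'\<in>H. e' \<noteq> e \<longrightarrow> fst e' \<noteq> fst e \<and> snd e' \<noteq> snd e}"

text \<open>Each edge of \<open>H\<close> that is not isolated is the first entry of an ordered pair
  of conflicting edges. The pairs range over the fixed set \<open>E \<times> E\<close>, so that
  \<open>sum_card_swap\<close> applies when \<open>H\<close> is random.\<close>

lemma card_isolated_edges:
  assumes "finite E" "H \<subseteq> E"
  shows "real (card (isolated_edges H)) \<ge> real (card H)
           - real (card {p \<in> E \<times> E. fst p \<in> H \<and> snd p \<in> H \<and> fst p \<noteq> snd p \<and> fst (fst p) = fst (snd p)})
           - real (card {p \<in> E \<times> E. fst p \<in> H \<and> snd p \<in> H \<and> fst p \<noteq> snd p \<and> snd (fst p) = snd (snd p)})"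
proof -
  define P where "P = {p \<in> E \<times> E. fst p \<in> H \<and> snd p \<in> H \<and> fst p \<noteq> snd p \<and> fst (fst p) = fst (snd p)}"
  define Q where "Q = {p \<in> E \<times> E. fst p \<in> H \<and> snd p \<in> H \<and> fst p \<noteq> snd p \<and> snd (fst p) = snd (snd p)}"
  have "P \<subseteq> E \<times> E" "Q \<subseteq> E \<times> E" "isolated_edges H \<subseteq> E"
    using assms(2) by (auto simp: P_def Q_def isolated_edges_def)
  hence fin: "finite P" "finite Q" "finite (isolated_edges H)"
    using assms(1) by (meson finite_SigmaI finite_subset)+
  have "H \<subseteq> isolated_edges H \<union> (fst ` P \<union> fst ` Q)"
  proof
    fix e assume e: "e \<in> H"
    show "e \<in> isolated_edges H \<union> (fst ` P \<union> fst ` Q)"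
    proof (cases "e \<in> isolated_edges H")
      case False
      then obtain e' where e': "e' \<in> H" "e' \<noteq> e" "fst e' = fst e \<or> snd e' = snd e"
        using e unfolding isolated_edges_def by blast
      hence "(e, e') \<in> P \<or> (e, e') \<in> Q"
        using e assms(2) unfolding P_def Q_def by auto
      thus ?thesis by (metis UnI1 UnI2 fst_conv image_eqI)
    qed simp
  qed
  hence "card H \<le> card (isolated_edges H \<union> (fst ` P \<union> fst ` Q))"
    using fin by (intro card_mono) simp_all
  also have "\<dots> \<le> card (isolated_edges H) + (card (fst ` P) + card (fst ` Q))"
    by (meson add_left_mono card_Un_le order_trans)
  also have "\<dots> \<le> card (isolated_edges H) + (card P + card Q)"
    using fin by (intro add_left_mono add_mono card_image_le)
  finally show ?thesis unfolding P_def[symmetric] Q_def[symmetric] by linarith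
qed

text \<open>Combines the counts on the two sides, in the form given by \<open>card_PiE_one\<close>
  and \<open>card_PiE_two\<close>, into a density on the product space.\<close>

lemma product_density:
  fixes u v :: real
  assumes "u * M ^ i = x * F" "v * M ^ j = y * G" "M > 0"
  shows "u * v = F * G * (x * y / M ^ (i + j))"
proof -
  have "u = x * F / M ^ i" "v = y * G / M ^ j"
    using assms by (simp_all add: eq_divide_eq)
  thus ?thesis by (simp add: power_add)
qed

text \<open>Bounds the expected conflicts at one side, \<open>\<pi>\<close> being the projection to
  the shared end. In the applications the two other ends are independent and enter only through
  \<open>C\<close>; for each fixed edge the overlaps at the shared end add up to at most
  \<open>w^2\<close> by \<open>sum_card_window_Int\<close>.\<close>

lemma sum_conflicts_le:
  fixes \<gamma> :: "'e \<Rightarrow> nat" and C D :: real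
  assumes fin: "finite \<Omega>" "finite E"
    and pair: "\<And>e e'. e \<in> E \<Longrightarrow> e' \<in> E \<Longrightarrow> e \<noteq> e' \<Longrightarrow> \<pi> e = \<pi> e' \<Longrightarrow>
        real (card {\<omega> \<in> \<Omega>. e \<in> H \<omega> \<and> e' \<in> H \<omega>}) = card (window (\<gamma> e) w \<inter> window (\<gamma> e') w) * C"
    and inj: "\<And>e e'. e \<in> E \<Longrightarrow> e' \<in> E \<Longrightarrow> e \<noteq> e' \<Longrightarrow> \<pi> e = \<pi> e' \<Longrightarrow> \<gamma> e \<noteq> \<gamma> e'"
    and C: "C \<ge> 0" "real w^2 * C \<le> D"
  shows "(\<Sum>\<omega>\<in>\<Omega>. real (card {p \<in> E \<times> E. fst p \<in> H \<omega> \<and> snd p \<in> H \<omega> \<and> fst p \<noteq> snd p \<and> \<pi> (fst p) = \<pi> (snd p)})) \<le> card E * D"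
proof -
  have "(\<Sum>\<omega>\<in>\<Omega>. real (card {p \<in> E \<times> E. fst p \<in> H \<omega> \<and> snd p \<in> H \<omega> \<and> fst p \<noteq> snd p \<and> \<pi> (fst p) = \<pi> (snd p)}))
      = (\<Sum>p\<in>E \<times> E. real (card {\<omega>\<in>\<Omega>. fst p \<in> H \<omega> \<and> snd p \<in> H \<omega> \<and> fst p \<noteq> snd p \<and> \<pi> (fst p) = \<pi> (snd p)}))"
    using fin by (intro sum_card_swap) simp_all
  also have "\<dots> = (\<Sum>e\<in>E. \<Sum>e'\<in>E. real (card {\<omega>\<in>\<Omega>. e \<in> H \<omega> \<and> e' \<in> H \<omega> \<and> e \<noteq> e' \<and> \<pi> e = \<pi> e'}))"
    by (simp add: sum.cartesian_product case_prod_beta)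
  also have "\<dots> \<le> (\<Sum>e\<in>E. D)"
  proof (rule sum_mono)
    fix e assume e: "e \<in> E"
    let ?N = "{e' \<in> E. e \<noteq> e' \<and> \<pi> e = \<pi> e'}"
    have injN: "inj_on \<gamma> ?N"
      using inj by (intro inj_onI) (metis (mono_tags, lifting) mem_Collect_eq)
    have "(\<Sum>e'\<in>E. real (card {\<omega>\<in>\<Omega>. e \<in> H \<omega> \<and> e' \<in> H \<omega> \<and> e \<noteq> e' \<and> \<pi> e = \<pi> e'})) = (\<Sum>e'\<in>?N. real (card {\<omega>\<in>\<Omega>. e \<in> H \<omega> \<and> e' \<in> H \<omega> \<and> e \<noteq> e' \<and> \<pi> e = \<pi> e'}))"
    proof (intro sum.mono_neutral_right ballI)
      fix e' assume "e' \<in> E - ?N"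
      hence "{\<omega>\<in>\<Omega>. e \<in> H \<omega> \<and> e' \<in> H \<omega> \<and> e \<noteq> e' \<and> \<pi> e = \<pi> e'} = {}" by blast
      thus "real (card {\<omega>\<in>\<Omega>. e \<in> H \<omega> \<and> e' \<in> H \<omega> \<and> e \<noteq> e' \<and> \<pi> e = \<pi> e'}) = 0"
        by (simp only: card.empty of_nat_0)
    qed (use fin in auto)
    also have "\<dots> = (\<Sum>e'\<in>?N. card (window (\<gamma> e) w \<inter> window (\<gamma> e') w) * C)"
      using pair e by (intro sum.cong) auto
    also have "\<dots> = real (\<Sum>e'\<in>?N. card (window (\<gamma> e) w \<inter> window (\<gamma> e') w)) * C"
      unfolding of_nat_sum sum_distrib_right ..
    also have "\<dots> \<le> real (w * w) * C"
      using sum_card_window_Int[OF _ injN] fin C(1)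
      by (intro mult_right_mono) (auto simp del: of_nat_mult of_nat_sum)
    also have "\<dots> \<le> D"
      using C(2) by (simp add: power2_eq_square)
    finally show "(\<Sum>e'\<in>E. real (card {\<omega>\<in>\<Omega>. e \<in> H \<omega> \<and> e' \<in> H \<omega> \<and> e \<noteq> e' \<and> \<pi> e = \<pi> e'})) \<le> D" .
  qed
  finally show ?thesis by simp
qed

text \<open>An edge belongs to the level with probability \<open>a * b / M^2\<close>. At either side
  the expected conflicts per edge are at most \<open>a^2 * b^2 / M^3\<close>, which is at most a
  quarter of that since \<open>4 * (a * b) \<le> M\<close>. Hence at least half of the expected
  edges are isolated.\<close>

lemma level_average:
  fixes E :: "('a \<times> 'b) set" and M :: nat
  defines "\<Omega> \<equiv> (fst ` E \<rightarrow>\<^sub>E {..<M}) \<times> (snd ` E \<rightarrow>\<^sub>E {..<M})"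
  assumes E: "finite E"
    and \<alpha>: "\<And>e e'. e \<in> E \<Longrightarrow> e' \<in> E \<Longrightarrow> e \<noteq> e' \<Longrightarrow> fst e = fst e' \<Longrightarrow> \<alpha> e \<noteq> \<alpha> e'"
    and \<beta>: "\<And>e e'. e \<in> E \<Longrightarrow> e' \<in> E \<Longrightarrow> e \<noteq> e' \<Longrightarrow> snd e = snd e' \<Longrightarrow> \<beta> e \<noteq> \<beta> e'"
    and M: "\<And>e. e \<in> E \<Longrightarrow> \<alpha> e + 2 * a \<le> M" "\<And>e. e \<in> E \<Longrightarrow> \<beta> e + 2 * b \<le> M"
    and ab: "4 * (a * b) \<le> M" "M > 0"
  shows "(\<Sum>\<omega>\<in>\<Omega>. real (card (isolated_edges (level_edges E \<alpha> \<beta> a b \<omega>))))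
           \<ge> real (card \<Omega>) * card E * (real a * real b / (2 * real M^2))"
proof -
  let ?F = "fst ` E \<rightarrow>\<^sub>E {..<M}" and ?G = "snd ` E \<rightarrow>\<^sub>E {..<M}"
  let ?H = "level_edges E \<alpha> \<beta> a b"
  have fin: "finite ?F" "finite ?G" "finite \<Omega>"
    using E by (auto simp: \<Omega>_def intro!: finite_PiE)
  have card\<Omega>: "card \<Omega> = card ?F * card ?G"
    by (simp add: \<Omega>_def card_cartesian_product)
  have M0: "real M > 0" using ab(2) by simp
  \<comment> \<open>Thresholds on the two sides are independent.\<close>
  have rect: "real (card {\<omega> \<in> \<Omega>. P (fst \<omega>) \<and> Q (snd \<omega>)}) = real (card {f \<in> ?F. P f}) * card {g \<in> ?G. Q g}" for P Q
  proof -
    have "{\<omega> \<in> \<Omega>. P (fst \<omega>) \<and> Q (snd \<omega>)} = {f \<in> ?F. P f} \<times> {g \<in> ?G. Q g}"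
      by (auto simp: \<Omega>_def)
    thus ?thesis by (simp add: card_cartesian_product)
  qed
  have single: "real (card {\<omega> \<in> \<Omega>. e \<in> ?H \<omega>}) = card \<Omega> * (real a * real b / real M^2)" if e: "e \<in> E" for e
  proof -
    have "{\<omega> \<in> \<Omega>. e \<in> ?H \<omega>}
        = {\<omega> \<in> \<Omega>. fst \<omega> (fst e) \<in> window (\<alpha> e) a \<and> snd \<omega> (snd e) \<in> window (\<beta> e) b}"
      using e unfolding level_edges_def by blast
    hence "real (card {\<omega> \<in> \<Omega>. e \<in> ?H \<omega>})
        = real (card {f \<in> ?F. f (fst e) \<in> window (\<alpha> e) a}) * card {g \<in> ?G. g (snd e) \<in> window (\<beta> e) b}"
      using rect by simp
    also have "\<dots> = real (card ?F) * card ?G * (real a * real b / real M ^ (1 + 1))"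
    proof (rule product_density)
      show "real (card {f \<in> ?F. f (fst e) \<in> window (\<alpha> e) a}) * real M ^ 1 = a * real (card ?F)"
        using card_PiE_one[of "fst ` E" "fst e" "window (\<alpha> e) a" M] E e M(1) window_subset by simp
      show "real (card {g \<in> ?G. g (snd e) \<in> window (\<beta> e) b}) * real M ^ 1 = b * real (card ?G)"
        using card_PiE_one[of "snd ` E" "snd e" "window (\<beta> e) b" M] E e M(2) window_subset by simp
    qed (rule M0)
    finally show ?thesis by (simp only: card\<Omega> of_nat_mult of_nat_power one_add_one)
  qed
  have pairA: "real (card {\<omega> \<in> \<Omega>. e \<in> ?H \<omega> \<and> e' \<in> ?H \<omega>})
      = card (window (\<alpha> e) a \<inter> window (\<alpha> e') a) * (card \<Omega> * (real b^2 / real M^3))"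
    if e: "e \<in> E" "e' \<in> E" "e \<noteq> e'" "fst e = fst e'" for e e'
  proof -
    let ?W = "window (\<alpha> e) a \<inter> window (\<alpha> e') a"
    \<comment> \<open>The graph is simple: edges with a common first end have distinct second ends,
      whose thresholds are independent.\<close>
    have snd: "snd e \<noteq> snd e'" using e(3,4) prod_eqI by blast
    have "{\<omega> \<in> \<Omega>. e \<in> ?H \<omega> \<and> e' \<in> ?H \<omega>} = {\<omega> \<in> \<Omega>. fst \<omega> (fst e) \<in> ?W
        \<and> (snd \<omega> (snd e) \<in> window (\<beta> e) b \<and> snd \<omega> (snd e') \<in> window (\<beta> e') b)}"
      using e(1,2,4) by (intro Collect_cong) (simp add: level_edges_def, argo)
    hence "real (card {\<omega> \<in> \<Omega>. e \<in> ?H \<omega> \<and> e' \<in> ?H \<omega>}) = real (card {f \<in> ?F. f (fst e) \<in> ?W})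
        * card {g \<in> ?G. g (snd e) \<in> window (\<beta> e) b \<and> g (snd e') \<in> window (\<beta> e') b}"
      by (simp only: rect[of "\<lambda>f. f (fst e) \<in> ?W"
            "\<lambda>g. g (snd e) \<in> window (\<beta> e) b \<and> g (snd e') \<in> window (\<beta> e') b"])
    also have "\<dots> = real (card ?F) * card ?G * (card ?W * (real b * b) / real M ^ (1 + 2))"
    proof (rule product_density)
      have "?W \<subseteq> {..<M}" using window_subset[OF M(1)[OF e(1)]] by blast
      thus "real (card {f \<in> ?F. f (fst e) \<in> ?W}) * real M ^ 1 = card ?W * real (card ?F)"
        using card_PiE_one[of "fst ` E" "fst e" ?W M] E e(1) by simp
      show "real (card {g \<in> ?G. g (snd e) \<in> window (\<beta> e) b \<and> g (snd e') \<in> window (\<beta> e') b}) * real M ^ 2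
          = real b * b * real (card ?G)"
        using card_PiE_two[of "snd ` E" "snd e" "snd e'" "window (\<beta> e) b" M "window (\<beta> e') b"]
          E e(1,2) snd M(2) window_subset by simp
    qed (rule M0)
    finally show ?thesis by (simp add: card\<Omega> power2_eq_square power3_eq_cube mult_ac)
  qed
  have pairB: "real (card {\<omega> \<in> \<Omega>. e \<in> ?H \<omega> \<and> e' \<in> ?H \<omega>})
      = card (window (\<beta> e) b \<inter> window (\<beta> e') b) * (card \<Omega> * (real a^2 / real M^3))"
    if e: "e \<in> E" "e' \<in> E" "e \<noteq> e'" "snd e = snd e'" for e e'
  proof -
    let ?W = "window (\<beta> e) b \<inter> window (\<beta> e') b"
    have fst: "fst e \<noteq> fst e'" using e(3,4) prod_eqI by blast
    have "{\<omega> \<in> \<Omega>. e \<in> ?H \<omega> \<and> e' \<in> ?H \<omega>} = {\<omega> \<in> \<Omega>. (fst \<omega> (fst e) \<in> window (\<alpha> e) a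
        \<and> fst \<omega> (fst e') \<in> window (\<alpha> e') a) \<and> snd \<omega> (snd e) \<in> ?W}"
      using e(1,2,4) by (intro Collect_cong) (simp add: level_edges_def, argo)
    hence "real (card {\<omega> \<in> \<Omega>. e \<in> ?H \<omega> \<and> e' \<in> ?H \<omega>})
        = real (card {f \<in> ?F. f (fst e) \<in> window (\<alpha> e) a \<and> f (fst e') \<in> window (\<alpha> e') a})
          * card {g \<in> ?G. g (snd e) \<in> ?W}"
      by (simp only: rect[of "\<lambda>f. f (fst e) \<in> window (\<alpha> e) a \<and> f (fst e') \<in> window (\<alpha> e') a"
            "\<lambda>g. g (snd e) \<in> ?W"])
    also have "\<dots> = real (card ?F) * card ?G * (real a * a * card ?W / real M ^ (2 + 1))"
    proof (rule product_density)
      show "real (card {f \<in> ?F. f (fst e) \<in> window (\<alpha> e) a \<and> f (fst e') \<in> window (\<alpha> e') a}) * real M ^ 2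
          = real a * a * real (card ?F)"
        using card_PiE_two[of "fst ` E" "fst e" "fst e'" "window (\<alpha> e) a" M "window (\<alpha> e') a"]
          E e(1,2) fst M(1) window_subset by simp
      have "?W \<subseteq> {..<M}" using window_subset[OF M(2)[OF e(1)]] by blast
      thus "real (card {g \<in> ?G. g (snd e) \<in> ?W}) * real M ^ 1 = card ?W * real (card ?G)"
        using card_PiE_one[of "snd ` E" "snd e" ?W M] E e(1) by simp
    qed (rule M0)
    finally show ?thesis by (simp add: card\<Omega> power2_eq_square power3_eq_cube mult_ac)
  qed
  \<comment> \<open>\<open>w\<close> and \<open>v\<close> stand for \<open>a\<close> and
    \<open>b\<close> in either order, so the bound serves conflicts at both sides.\<close>
  have small: "real w^2 * (card \<Omega> * (real v^2 / real M^3)) \<le> card \<Omega> * (real a * real b / (4 * real M^2))" if "w * v = a * b" for w v :: nat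
  proof -
    have "real w^2 * real v^2 / real M^3 = (real w * real v) / real M^2 * ((real w * real v) / M)"
      by (simp add: power2_eq_square power3_eq_cube)
    also have "real w * real v = real a * real b"
      using that by (metis of_nat_mult)
    also have "real a * real b / real M^2 * (real a * real b / M) \<le> real a * real b / real M^2 * (1 / 4)"
    proof (rule mult_left_mono)
      have "4 * (real a * real b) \<le> M" using ab(1) by (metis of_nat_le_iff of_nat_mult of_nat_numeral)
      thus "real a * real b / M \<le> 1 / 4" using M0 by (simp add: field_simps)
    qed simp
    finally have "real w^2 * real v^2 / real M^3 \<le> real a * real b / (4 * real M^2)" by simp
    hence "card \<Omega> * (real w^2 * real v^2 / real M^3) \<le> card \<Omega> * (real a * real b / (4 * real M^2))"
      by (rule mult_left_mono) simp
    thus ?thesis by (simp add: mult.left_commute)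
  qed
  have total: "(\<Sum>\<omega>\<in>\<Omega>. real (card (?H \<omega>))) = card E * (card \<Omega> * (real a * real b / real M^2))"
  proof -
    have "(\<Sum>\<omega>\<in>\<Omega>. real (card (?H \<omega>))) = (\<Sum>\<omega>\<in>\<Omega>. real (card {e \<in> E. e \<in> ?H \<omega>}))"
      by (intro sum.cong refl arg_cong[where f="\<lambda>A. real (card A)"]) (auto simp: level_edges_def)
    also have "\<dots> = (\<Sum>e\<in>E. real (card {\<omega> \<in> \<Omega>. e \<in> ?H \<omega>}))"
      using fin E by (intro sum_card_swap)
    finally show ?thesis using single by simp
  qed
  let ?P = "\<lambda>\<pi>::'a \<times> 'b \<Rightarrow> 'a. \<lambda>\<omega>. {p \<in> E \<times> E. fst p \<in> ?H \<omega> \<and> snd p \<in> ?H \<omega> \<and> fst p \<noteq> snd p \<and> \<pi> (fst p) = \<pi> (snd p)}"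
  let ?Q = "\<lambda>\<pi>::'a \<times> 'b \<Rightarrow> 'b. \<lambda>\<omega>. {p \<in> E \<times> E. fst p \<in> ?H \<omega> \<and> snd p \<in> ?H \<omega> \<and> fst p \<noteq> snd p \<and> \<pi> (fst p) = \<pi> (snd p)}"
  have "(\<Sum>\<omega>\<in>\<Omega>. real (card (?H \<omega>)) - card (?P fst \<omega>) - card (?Q snd \<omega>))
      \<le> (\<Sum>\<omega>\<in>\<Omega>. real (card (isolated_edges (?H \<omega>))))"
    by (rule sum_mono, rule card_isolated_edges[OF E]) (simp add: level_edges_def)
  moreover have "(\<Sum>\<omega>\<in>\<Omega>. real (card (?P fst \<omega>))) \<le> card E * (card \<Omega> * (real a * real b / (4 * real M^2)))"
    by (rule sum_conflicts_le[OF fin(3) E pairA \<alpha> _ small]) simp_all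
  moreover have "(\<Sum>\<omega>\<in>\<Omega>. real (card (?Q snd \<omega>))) \<le> card E * (card \<Omega> * (real a * real b / (4 * real M^2)))"
    by (rule sum_conflicts_le[OF fin(3) E pairB \<beta> _ small]) simp_all
  \<comment> \<open>With \<open>T\<close> the sum of the level sizes over \<open>\<Omega>\<close>,
    the remaining estimate is \<open>T - T/4 - T/4 = T/2\<close>.\<close>
  moreover define T where "T = card E * (card \<Omega> * (real a * real b / real M^2))"
  moreover have "card E * (card \<Omega> * (real a * real b / (4 * real M^2))) = T / 4"
    "real (card \<Omega>) * card E * (real a * real b / (2 * real M^2)) = T / 2"
    by (simp_all add: T_def mult_ac)
  ultimately show ?thesis
    unfolding sum_subtractf total by linarith
qed

section \<open>Admissible levels and the thinned subgraph\<close>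

text \<open>\<open>3 * s \<le> K\<close> keeps \<open>K - 3 * s\<close> from truncating, so that the
  window widths \<open>8^s\<close> and \<open>2^(K - 3 * s)\<close> multiply to \<open>2^K\<close>.
  \<open>K \<le> 6 * s + 1\<close> makes the second width at most twice the first.\<close>

definition levels :: "nat \<Rightarrow> nat set" where
  "levels K = {s. K \<le> 6 * s + 1 \<and> 3 * s \<le> K}"

text \<open>The levels run from about \<open>K/6\<close> to \<open>K/3\<close>; the 2 absorbs the
  rounding at both ends.\<close>

lemma card_levels: "K \<le> 6 * card (levels K) + 2"
proof -
  have "levels K = {(K + 4) div 6..<K div 3 + 1}"
    by (auto simp: levels_def; presburger)
  hence "card (levels K) = K div 3 + 1 - (K + 4) div 6" by simp
  moreover have "K \<le> 3 * (K div 3) + 2" "6 * ((K + 4) div 6) \<le> K + 4" by presburger+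
  ultimately show ?thesis by linarith
qed

lemma finite_levels [simp]: "finite (levels K)"
  by (rule finite_subset[of _ "{..K}"]) (auto simp: levels_def)

text \<open>The distance \<open>m - p\<close> is below \<open>2 * 8^i\<close> at level
  \<open>i\<close> and at least \<open>8 * 8^i\<close> at any higher level. Hence a threshold
  determines the level of an edge.\<close>

lemma window_8_disjoint:
  assumes "m \<in> window p (8 ^ s)" "m \<in> window p (8 ^ s')"
  shows "s = s'"
proof -
  have "\<not> i < j" if "m \<in> window p (8 ^ i)" "m \<in> window p (8 ^ j)" for i j
  proof
    assume "i < j"
    hence "(8::nat) ^ Suc i \<le> 8 ^ j" by (intro power_increasing) auto
    thus False using that by (auto simp: window_def)
  qed
  thus ?thesis using assms by (meson linorder_neqE_nat)
qed

text \<open>The probabilistic core, general in \<open>\<alpha>\<close> and \<open>\<beta>\<close> to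
  cover both kinds of walk: \<open>level_average\<close> is summed over all levels and one good pair
  of thresholds is picked.\<close>

lemma thinning:
  fixes E :: "('a \<times> 'b) set"
  assumes E: "finite E" "E \<noteq> {}"
    and inj: "\<And>x. inj_on \<alpha> {e \<in> E. fst e = x}" "\<And>y. inj_on \<beta> {e \<in> E. snd e = y}"
    and le: "\<forall>e\<in>E. \<alpha> e \<le> d" "\<forall>e\<in>E. \<beta> e \<le> d"
    and K: "2 ^ K \<le> d" "d < 2 ^ Suc K"
  obtains E' lev f g where "E' \<subseteq> E"
    and "\<And>e. e \<in> E' \<Longrightarrow> lev e \<in> levels K"
    and "\<And>e. e \<in> E' \<Longrightarrow> f (fst e) \<in> window (\<alpha> e) (8 ^ lev e)"
    and "\<And>e. e \<in> E' \<Longrightarrow> g (snd e) \<in> window (\<beta> e) (2 ^ (K - 3 * lev e))"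
    and "\<And>e e'. e \<in> E' \<Longrightarrow> e' \<in> E' \<Longrightarrow> e \<noteq> e' \<Longrightarrow> fst e = fst e' \<or> snd e = snd e' \<Longrightarrow> lev e \<noteq> lev e'"
    and "real (card E') \<ge> card E * (card (levels K) * (2 ^ K / (32 * real d ^ 2)))"
proof -
  have \<alpha>: "\<And>e e'. e \<in> E \<Longrightarrow> e' \<in> E \<Longrightarrow> e \<noteq> e' \<Longrightarrow> fst e = fst e' \<Longrightarrow> \<alpha> e \<noteq> \<alpha> e'"
    and \<beta>: "\<And>e e'. e \<in> E \<Longrightarrow> e' \<in> E \<Longrightarrow> e \<noteq> e' \<Longrightarrow> snd e = snd e' \<Longrightarrow> \<beta> e \<noteq> \<beta> e'"
    using inj unfolding inj_on_def by (metis (mono_tags, lifting) mem_Collect_eq)+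
  \<comment> \<open>The factor 4 gives \<open>4 * 2^K \<le> M\<close>, as
    \<open>level_average\<close> requires, and leaves room for the windows, whose upper ends are at
    most \<open>d + 2 * 2^K \<le> 3 * d\<close>.\<close>
  define M where "M = 4 * d"
  define \<Omega> where "\<Omega> = (fst ` E \<rightarrow>\<^sub>E {..<M}) \<times> (snd ` E \<rightarrow>\<^sub>E {..<M})"
  define L where "L s \<omega> = level_edges E \<alpha> \<beta> (8 ^ s) (2 ^ (K - 3 * s)) \<omega>" for s \<omega>
  define I where "I s \<omega> = isolated_edges (L s \<omega>)" for s \<omega>
  have d0: "d > 0" using K(1) by (rule less_le_trans[rotated]) simp
  have fin\<Omega>: "finite \<Omega>" using E by (auto simp: \<Omega>_def intro!: finite_PiE)
  have "card \<Omega> > 0"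
    using E d0 by (auto simp: \<Omega>_def card_cartesian_product card_PiE M_def)
  hence \<Omega>0: "real (card \<Omega>) > 0" by simp
  \<comment> \<open>\<open>2^K / (32 * d^2)\<close> is \<open>a * b / (2 * M^2)\<close> for widths
    with \<open>a * b = 2^K\<close> and for \<open>M = 4 * d\<close>.\<close>
  let ?b = "card E * (card (levels K) * (2 ^ K / (32 * real d ^ 2)))"
  have "card \<Omega> * (card E * (2 ^ K / (32 * real d ^ 2))) \<le> (\<Sum>\<omega>\<in>\<Omega>. real (card (I s \<omega>)))"
    if s: "s \<in> levels K" for s
  proof -
    have s3: "3 * s \<le> K" using s by (simp add: levels_def)
    have prod: "(8::nat) ^ s * 2 ^ (K - 3 * s) = 2 ^ K"
    proof -
      have "(8::nat) ^ s = 2 ^ (3 * s)" by (simp add: power_mult)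
      thus ?thesis using s3 by (simp flip: power_add)
    qed
    have "(8::nat) ^ s \<le> 2 ^ K" "(2::nat) ^ (K - 3 * s) \<le> 2 ^ K"
      unfolding prod[symmetric] by auto
    hence "\<alpha> e + 2 * 8 ^ s \<le> M" "\<beta> e + 2 * 2 ^ (K - 3 * s) \<le> M" if "e \<in> E" for e
      using bspec[OF le(1) that] bspec[OF le(2) that] K(1) unfolding M_def by linarith+
    hence "(\<Sum>\<omega>\<in>\<Omega>. real (card (I s \<omega>))) \<ge> real (card \<Omega>) * card E * (real (8 ^ s) * real (2 ^ (K - 3 * s)) / (2 * real M^2))"
      unfolding I_def L_def \<Omega>_def using E(1) \<alpha> \<beta> K(1) d0
      by (intro level_average) (auto simp: M_def prod)
    also have "real (8 ^ s) * real (2 ^ (K - 3 * s)) = 2 ^ K"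
      using prod by (metis of_nat_mult of_nat_numeral of_nat_power)
    finally show ?thesis by (simp add: M_def power_mult_distrib mult_ac)
  qed
  hence "(\<Sum>s\<in>levels K. card \<Omega> * (card E * (2 ^ K / (32 * real d ^ 2))))
      \<le> (\<Sum>s\<in>levels K. \<Sum>\<omega>\<in>\<Omega>. real (card (I s \<omega>)))"
    by (intro sum_mono)
  hence avg: "card \<Omega> * ?b \<le> (\<Sum>\<omega>\<in>\<Omega>. \<Sum>s\<in>levels K. real (card (I s \<omega>)))"
    by (subst sum.swap) (simp add: mult_ac)
  \<comment> \<open>First moment argument: some pair of thresholds does at least as well as the
    average.\<close>
  have "\<exists>\<omega>\<in>\<Omega>. ?b \<le> (\<Sum>s\<in>levels K. real (card (I s \<omega>)))"
  proof (rule ccontr)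
    assume "\<not> ?thesis"
    hence "(\<Sum>\<omega>\<in>\<Omega>. \<Sum>s\<in>levels K. real (card (I s \<omega>))) < (\<Sum>\<omega>\<in>\<Omega>. ?b)"
      using fin\<Omega> \<Omega>0 by (intro sum_strict_mono) (auto simp: not_le)
    thus False using avg by simp
  qed
  then obtain f g where fg: "?b \<le> (\<Sum>s\<in>levels K. real (card (I s (f, g))))"
    by auto
  define E' where "E' = (\<Union>s\<in>levels K. I s (f, g))"
  define lev where "lev e = (SOME s. s \<in> levels K \<and> e \<in> I s (f, g))" for e
  have sub: "I s (f, g) \<subseteq> L s (f, g)" "L s (f, g) \<subseteq> E" for s
    by (auto simp: I_def L_def isolated_edges_def level_edges_def)
  have lev: "lev e \<in> levels K \<and> e \<in> I (lev e) (f, g)" if "e \<in> E'" for e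
    unfolding lev_def by (rule someI_ex) (use that in \<open>auto simp: E'_def\<close>)
  have mem: "f (fst e) \<in> window (\<alpha> e) (8 ^ s)" "g (snd e) \<in> window (\<beta> e) (2 ^ (K - 3 * s))"
    if "e \<in> I s (f, g)" for e s
    using that sub by (auto simp: L_def level_edges_def)
  \<comment> \<open>The levels contribute disjoint edge sets, because the threshold at the first end
    already determines the level of an edge.\<close>
  have "card E' = (\<Sum>s\<in>levels K. card (I s (f, g)))"
    unfolding E'_def
  proof (rule card_UN_disjoint)
    show "\<forall>s\<in>levels K. finite (I s (f, g))"
      using sub E(1) by (meson finite_subset)
    show "\<forall>s\<in>levels K. \<forall>s'\<in>levels K. s \<noteq> s' \<longrightarrow> I s (f, g) \<inter> I s' (f, g) = {}"
      using mem(1) window_8_disjoint by blast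
  qed simp
  hence "real (card E') \<ge> ?b" using fg by simp
  moreover have "lev e \<noteq> lev e'"
    if "e \<in> E'" "e' \<in> E'" "e \<noteq> e'" "fst e = fst e' \<or> snd e = snd e'" for e e'
    using lev[OF that(1)] lev[OF that(2)] that(3,4) by (auto simp: I_def isolated_edges_def)
  ultimately show ?thesis
    using that[of E' lev f g] lev mem sub by (force simp: E'_def)
qed

section \<open>Color gaps at a vertex\<close>

text \<open>Both colors are measured against one threshold: the smaller lies further below it and so
  has the higher level. The difference is \<open>(f - c) - (f - c')\<close>, whose second term is
  below \<open>2 * 8^s'\<close>, at most a quarter of \<open>8^s\<close>.\<close>

lemma window_8_gap:
  assumes "f \<in> window c (8 ^ s)" "f \<in> window c' (8 ^ s')" "c < c'" "s \<noteq> s'"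
  shows "s' < s" "3 * 8 ^ s < 4 * (c' - c)" "c' - c < 2 * 8 ^ s"
proof -
  show "s' < s"
  proof (rule ccontr)
    assume "\<not> s' < s"
    hence "(8::nat) ^ Suc s \<le> 8 ^ s'" using assms(4) by (intro power_increasing) auto
    thus False using assms by (auto simp: window_def)
  qed
  hence "(8::nat) ^ Suc s' \<le> 8 ^ s" by (intro power_increasing) auto
  thus "3 * 8 ^ s < 4 * (c' - c)" "c' - c < 2 * 8 ^ s"
    using assms by (auto simp: window_def)
qed

text \<open>Widths here decrease with the level, so the direction of \<open>window_8_gap\<close> is
  reversed. The bound in terms of \<open>8^s\<close> makes the jump comparable with jumps at the
  other side; it comes from \<open>2^(K - 3 * s) \<le> 2 * 8^s\<close>.\<close>

lemma window_2_gap: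
  assumes "g \<in> window c (2 ^ (K - 3 * s))" "g \<in> window c' (2 ^ (K - 3 * s'))" "c < c'" "s \<noteq> s'"
    and "s \<in> levels K"
  shows "s < s'" "c' - c < 2 * 2 ^ (K - 3 * s)" "c' - c < 4 * 8 ^ s"
proof -
  have s: "3 * s \<le> K" "K - 3 * s \<le> Suc (3 * s)"
    using assms(5) by (auto simp: levels_def)
  show "s < s'"
  proof (rule ccontr)
    assume "\<not> s < s'"
    \<comment> \<open>As \<open>3 * s \<le> K\<close>, nothing is truncated and a lower
      \<open>s'\<close> has a strictly larger exponent.\<close>
    hence "Suc (K - 3 * s) \<le> K - 3 * s'" using assms(4) s by linarith
    hence "(2::nat) ^ Suc (K - 3 * s) \<le> 2 ^ (K - 3 * s')" by (intro power_increasing) auto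
    thus False using assms by (auto simp: window_def)
  qed
  have "(2::nat) ^ (K - 3 * s) \<le> 2 ^ Suc (3 * s)"
    using s by (intro power_increasing) auto
  hence "(2::nat) ^ (K - 3 * s) \<le> 2 * 8 ^ s" by (simp add: power_mult)
  moreover show "c' - c < 2 * 2 ^ (K - 3 * s)"
    using assms by (auto simp: window_def)
  ultimately show "c' - c < 4 * 8 ^ s" by linarith
qed

section \<open>Walks of length 4 in a bipartite graph\<close>

text \<open>All edges point from \<open>A\<close> to \<open>B\<close>, so the orientation of the
  first one fixes that of the others and resolves every \<open>edge_color\<close>. Vertices named
  \<open>x\<close> lie in \<open>A\<close>, those named \<open>y\<close> in
  \<open>B\<close>.\<close>

lemma walk_4_cases:
  assumes bip: "bipartite_graph A B E" and walk: "walk A B E 4 vs"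
  obtains (from_B) x1 x3 y0 y2 y4 where "vs ! 0 = y0"
      "(x1, y0) \<in> E" "(x1, y2) \<in> E" "(x3, y2) \<in> E" "(x3, y4) \<in> E"
      "walk_coloring E \<chi> vs = [\<chi> (x1, y0), \<chi> (x1, y2), \<chi> (x3, y2), \<chi> (x3, y4)]"
    | (from_A) x0 x2 x4 y1 y3 where "vs ! 0 = x0"
      "(x0, y1) \<in> E" "(x2, y1) \<in> E" "(x2, y3) \<in> E" "(x4, y3) \<in> E"
      "walk_coloring E \<chi> vs = [\<chi> (x0, y1), \<chi> (x2, y1), \<chi> (x2, y3), \<chi> (x4, y3)]"
proof -
  have len: "length vs = 5" using walk by (simp add: walk_def)
  define v0 v1 v2 v3 v4 where v: "v0 = vs ! 0" "v1 = vs ! 1" "v2 = vs ! 2" "v3 = vs ! 3" "v4 = vs ! 4"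
  have "\<forall>i\<in>{1..4}. adjacent E (vs ! (i - 1)) (vs ! i)"
    using walk by (simp add: walk_def)
  from this[THEN bspec, of 1] this[THEN bspec, of 2] this[THEN bspec, of 3] this[THEN bspec, of 4]
  have adj: "adjacent E v0 v1" "adjacent E v1 v2" "adjacent E v2 v3" "adjacent E v3 v4"
    by (simp_all add: v)
  have AB: "A \<inter> B = {}" "\<And>x y. (x, y) \<in> E \<Longrightarrow> x \<in> A \<and> y \<in> B"
    using bip by (auto simp: bipartite_graph_def)
  have "[1..<length vs] = [1, 2, 3, 4]"
    by (simp add: len upt_rec)
  hence col: "walk_coloring E \<chi> vs
      = [edge_color E \<chi> v0 v1, edge_color E \<chi> v1 v2, edge_color E \<chi> v2 v3, edge_color E \<chi> v3 v4]"
    by (simp add: walk_coloring_def v)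
  have asym: "(x, y) \<notin> E" if "(y, z) \<in> E \<or> (z, x) \<in> E" for x y z
    using that AB by blast
  show thesis
  proof (cases "(v1, v0) \<in> E")
    case True
    moreover have "(v1, v2) \<in> E" using adj asym True unfolding adjacent_def by blast
    moreover have "(v3, v2) \<in> E" using adj asym calculation unfolding adjacent_def by blast
    moreover have "(v3, v4) \<in> E" using adj asym calculation unfolding adjacent_def by blast
    moreover have "(v0, v1) \<notin> E" "(v2, v3) \<notin> E"
      using calculation asym by blast+
    ultimately show thesis
      using from_B[of v0 v1 v2 v3 v4] col by (simp add: edge_color_def v(1))
  next
    case False
    hence "(v0, v1) \<in> E" using adj by (simp add: adjacent_def)
    moreover have "(v2, v1) \<in> E" using adj asym calculation unfolding adjacent_def by blast
    moreover have "(v2, v3) \<in> E" using adj asym calculation unfolding adjacent_def by blast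
    moreover have "(v4, v3) \<in> E" using adj asym calculation unfolding adjacent_def by blast
    moreover have "(v1, v2) \<notin> E" "(v3, v4) \<notin> E"
      using calculation asym by blast+
    ultimately show thesis
      using from_A[of v0 v1 v2 v3 v4] col by (simp add: edge_color_def v(1))
  qed
qed

section \<open>The theorem: one color class for small \<open>d\<close>, thinning for large
  \<open>d\<close>\<close>

text \<open>Pigeonhole over the \<open>d\<close> colors.\<close>

lemma large_color_class:
  assumes "finite E" "E \<noteq> {}" "\<And>e. e \<in> E \<Longrightarrow> \<chi> e \<in> {1..d}"
  obtains c where "card E \<le> d * card {e \<in> E. \<chi> e = c}"
proof -
  obtain e0 where "e0 \<in> E" using assms(2) by blast
  hence "1 \<le> d" using assms(3)[of e0] by simp
  have fibers: "card E = (\<Sum>c\<in>{1..d}. card {e \<in> E. \<chi> e = c})"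
    using sum.group[of E "{1..d}" \<chi> "\<lambda>_. 1::nat"] assms by (simp add: image_subset_iff)
  show thesis
  proof (rule ccontr)
    assume "\<not> thesis"
    hence *: "d * card {e \<in> E. \<chi> e = c} < card E" for c
      using that not_le by blast
    have "d * card E = d * (\<Sum>c\<in>{1..d}. card {e \<in> E. \<chi> e = c})" by (simp only: fibers[symmetric])
    also have "\<dots> = (\<Sum>c\<in>{1..d}. d * card {e \<in> E. \<chi> e = c})" by (simp add: sum_distrib_left)
    also have "\<dots> < (\<Sum>c\<in>{1..d}. card E)"
      using * \<open>1 \<le> d\<close> by (intro sum_strict_mono) auto
    finally show False by simp
  qed
qed

theorem theorem7:
  fixes A B :: "'v set" and E :: "('v \<times> 'v) set" and d :: nat and \<chi> :: "'v \<times> 'v \<Rightarrow> nat"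
  assumes "bipartite_graph A B E"
    and "finite E" and "E \<noteq> {}"
    and "proper_edge_coloring E d \<chi>"
  shows "(\<exists>E'. E' \<subseteq> E \<and> (\<nexists>vs. slow_walk A B E' \<chi> vs) \<and>
            real (card E') > log 2 (real d) / (480 * real d) * real (card E)) \<and>
         (\<exists>E''. E'' \<subseteq> E \<and> (\<nexists>vs. fast_walk A B E'' \<chi> vs) \<and>
            real (card E'') > log 2 (real d) / (480 * real d) * real (card E))"
proof -
  have \<chi>d: "\<And>e. e \<in> E \<Longrightarrow> \<chi> e \<in> {1..d}"
    using assms(4) by (simp add: proper_edge_coloring_def)
  have proper: "\<chi> e \<noteq> \<chi> e'" if "e \<in> E" "e' \<in> E" "e \<noteq> e'" "fst e = fst e' \<or> snd e = snd e'" for e e'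
    using assms(4) that unfolding proper_edge_coloring_def by blast
  have injA: "inj_on \<chi> {e \<in> E. fst e = x}" and injB: "inj_on \<chi> {e \<in> E. snd e = x}" for x
    using proper unfolding inj_on_def by (metis (mono_tags, lifting) mem_Collect_eq)+
  have \<chi>_le: "\<forall>e\<in>E. \<chi> e \<le> d"
    using \<chi>d by simp
  have d0: "d > 0" using \<chi>d assms(3) by fastforce
  have E0: "real (card E) > 0" using assms(2,3) by (simp add: card_gt_0_iff)
  have bip: "bipartite_graph A B E'" if "E' \<subseteq> E" for E'
    using assms(1) that by (auto simp: bipartite_graph_def)
  obtain K where K: "2 ^ K \<le> d" "d < 2 ^ Suc K"
    using ex_power_ivl1[of 2 d] d0 by auto
  have logd: "log 2 (real d) < real K + 1"
  proof -
    have "real d < 2 ^ Suc K" using K(2) by (metis of_nat_less_iff of_nat_numeral of_nat_power)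
    thus ?thesis using d0 by (subst log_less_iff) (auto simp: powr_add powr_realpow)
  qed
  show ?thesis
  \<comment> \<open>For \<open>n\<close> levels \<open>card_levels\<close> gives
    \<open>480 * n \<ge> 80 * (K - 2)\<close>, and this is at least \<open>64 * (K + 1)\<close> from
    \<open>K = 14\<close> on. Below that \<open>log 2 d < 14\<close>, and one color class has enough
    edges.\<close>
  proof (cases "K < 14")
    case True
    obtain c where c: "card E \<le> d * card {e \<in> E. \<chi> e = c}"
      using large_color_class[of E \<chi> d] assms(2,3) \<chi>d by blast
    let ?C = "{e \<in> E. \<chi> e = c}"
    have "log 2 (real d) / (480 * real d) * card E < 480 / (480 * real d) * card E"
      using True logd d0 E0 by (intro mult_strict_right_mono divide_strict_right_mono) auto
    also have "\<dots> \<le> card ?C"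
      using c d0 by (simp add: field_simps flip: of_nat_mult)
    finally have card: "log 2 (real d) / (480 * real d) * card E < card ?C" .
    have bipC: "bipartite_graph A B ?C" by (rule bip) auto
    \<comment> \<open>Walks inside a color class have constant coloring, whereas both forbidden
      patterns ask for \<open>c2 < c3\<close>.\<close>
    have "\<not> (slow_walk A B ?C \<chi> vs \<or> fast_walk A B ?C \<chi> vs)" for vs
    proof
      assume "slow_walk A B ?C \<chi> vs \<or> fast_walk A B ?C \<chi> vs"
      then obtain c1 c2 c3 c4 where w: "walk A B ?C 4 vs"
        and col: "walk_coloring ?C \<chi> vs = [c1, c2, c3, c4]" "c2 < c3"
        unfolding slow_walk_def fast_walk_def by blast
      from bipC w show False
        by (cases rule: walk_4_cases[where \<chi> = \<chi>]) (use col in auto)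
    qed
    moreover have "?C \<subseteq> E" by blast
    ultimately show ?thesis using card by blast
  next
    case False
    have bound: "log 2 (real d) / (480 * real d) * card E < card F"
      if "real (card F) \<ge> card E * (card (levels K) * (2 ^ K / (32 * real d ^ 2)))" for F :: "('v \<times> 'v) set"
    proof -
      let ?n = "real (card (levels K))"
      have "real K \<le> 6 * ?n + 2" using card_levels[of K] by linarith
      hence n: "64 * log 2 (real d) < 480 * ?n" using False logd by linarith
      have "real d < 2 * 2 ^ K" using K(2) by (metis of_nat_less_iff of_nat_numeral of_nat_power power_Suc)
      \<comment> \<open>Since \<open>d < 2 * 2^K\<close>, the density guaranteed per level is at
        least \<open>1 / (64 * d)\<close>.\<close>
      hence "1 / (64 * real d) \<le> 2 ^ K / (32 * real d ^ 2)"
        using d0 by (simp add: field_simps power2_eq_square)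
      hence "?n * (1 / (64 * real d)) \<le> ?n * (2 ^ K / (32 * real d ^ 2))"
        by (intro mult_left_mono) auto
      moreover have "log 2 (real d) / (480 * real d) < ?n * (1 / (64 * real d))"
        using n d0 by (simp add: field_simps)
      ultimately have "log 2 (real d) / (480 * real d) * card E < ?n * (2 ^ K / (32 * real d ^ 2)) * card E"
        using E0 by (intro mult_strict_right_mono) auto
      thus ?thesis using that by (simp add: mult_ac)
    qed
    have "\<exists>E'. E' \<subseteq> E \<and> (\<nexists>vs. slow_walk A B E' \<chi> vs) \<and>
            real (card E') > log 2 (real d) / (480 * real d) * real (card E)"
    proof -
      \<comment> \<open>Reflection gives the larger of two colors at a vertex of \<open>B\<close>
        the lower level, as at a vertex of \<open>A\<close>. Truncation is harmless because colors
        are at most \<open>d\<close>.\<close>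
      have injB': "inj_on (\<lambda>e. d - \<chi> e) {e \<in> E. snd e = y}" for y
      proof (rule inj_onI)
        fix e e' assume e: "e \<in> {e \<in> E. snd e = y}" "e' \<in> {e \<in> E. snd e = y}" "d - \<chi> e = d - \<chi> e'"
        have "\<chi> e \<le> d" "\<chi> e' \<le> d" using e(1,2) \<chi>_le by simp_all
        hence "\<chi> e = \<chi> e'" using e(3) by linarith
        thus "e = e'" using e(1,2) injB by (blast dest: inj_onD)
      qed
      have diff_le: "\<forall>e\<in>E. d - \<chi> e \<le> d" by simp
      obtain E' lev f g where E': "E' \<subseteq> E"
        and lev: "\<And>e. e \<in> E' \<Longrightarrow> lev e \<in> levels K"
        and f: "\<And>e. e \<in> E' \<Longrightarrow> f (fst e) \<in> window (\<chi> e) (8 ^ lev e)"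
        and g: "\<And>e. e \<in> E' \<Longrightarrow> g (snd e) \<in> window (d - \<chi> e) (2 ^ (K - 3 * lev e))"
        and lev_neq: "\<And>e e'. e \<in> E' \<Longrightarrow> e' \<in> E' \<Longrightarrow> e \<noteq> e' \<Longrightarrow> fst e = fst e' \<or> snd e = snd e' \<Longrightarrow> lev e \<noteq> lev e'"
        and card: "real (card E') \<ge> card E * (card (levels K) * (2 ^ K / (32 * real d ^ 2)))"
        by (rule thinning[OF assms(2,3) injA injB' \<chi>_le diff_le K]) (rule that, assumption+)
      have "\<not> slow_walk A B E' \<chi> vs" for vs
      proof
        assume "slow_walk A B E' \<chi> vs"
        then obtain c1 c2 c3 c4 where w: "walk A B E' 4 vs" "vs ! 0 \<in> B"
          and c: "walk_coloring E' \<chi> vs = [c1, c2, c3, c4]" "c2 < c3" "c3 < c4" "c2 < c1" "c1 \<le> c4"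
          unfolding slow_walk_def by blast
        from bip[OF E'] w(1) show False
        proof (cases rule: walk_4_cases[where \<chi>=\<chi>])
          case (from_B x1 x3 y0 y2 y4)
          define s1 s2 s3 s4 where s: "s1 = lev (x1, y0)" "s2 = lev (x1, y2)" "s3 = lev (x3, y2)" "s4 = lev (x3, y4)"
          have cs: "c1 = \<chi> (x1, y0)" "c2 = \<chi> (x1, y2)" "c3 = \<chi> (x3, y2)" "c4 = \<chi> (x3, y4)"
            using c(1) from_B(6) by auto
          have "(x1, y2) \<noteq> (x1, y0)" "(x3, y2) \<noteq> (x1, y2)" "(x3, y2) \<noteq> (x3, y4)"
            using c(2-5) cs by auto
          hence neq: "s2 \<noteq> s1" "s3 \<noteq> s2" "s3 \<noteq> s4"
            unfolding s using from_B(2-5) lev_neq by auto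
          have 12: "3 * 8 ^ s2 < 4 * (c1 - c2)"
            by (rule window_8_gap(2)[of "f x1" c2 s2 c1 s1])
               (use f[of "(x1, y0)"] f[of "(x1, y2)"] from_B cs s c neq in auto)
          have 34: "c4 - c3 < 2 * 8 ^ s3"
            by (rule window_8_gap(3)[of "f x3" c3 s3 c4 s4])
               (use f[of "(x3, y2)"] f[of "(x3, y4)"] from_B cs s c neq in auto)
          have "c3 \<le> d" using \<chi>d[of "(x3, y2)"] from_B E' cs by auto
          hence "d - c3 < d - c2" using c by linarith
          hence 23: "s3 < s2" "(d - c2) - (d - c3) < 4 * 8 ^ s3"
            using window_2_gap[of "g y2" "d - c3" K s3 "d - c2" s2]
              g[of "(x3, y2)"] g[of "(x1, y2)"] lev[of "(x3, y2)"] from_B cs s neq by auto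
          \<comment> \<open>\<open>c4 - c2 = (c4 - c3) + (c3 - c2) < 6 * 8^s3 \<le> 3/4 * 8^s2 < c1
            - c2\<close>, against \<open>c1 \<le> c4\<close>.\<close>
          have "(8::nat) ^ Suc s3 \<le> 8 ^ s2" using 23(1) by (intro power_increasing) auto
          thus False using 12 34 23(2) c \<open>c3 \<le> d\<close> by auto
        next
          case from_A
          thus False using w(2) bip[OF E'] by (auto simp: bipartite_graph_def)
        qed
      qed
      thus ?thesis using E' bound[OF card] by blast
    qed
    moreover have "\<exists>E''. E'' \<subseteq> E \<and> (\<nexists>vs. fast_walk A B E'' \<chi> vs) \<and>
            real (card E'') > log 2 (real d) / (480 * real d) * real (card E)"
    proof -
      obtain E' lev f g where E': "E' \<subseteq> E"
        and lev: "\<And>e. e \<in> E' \<Longrightarrow> lev e \<in> levels K"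
        and f: "\<And>e. e \<in> E' \<Longrightarrow> f (fst e) \<in> window (\<chi> e) (8 ^ lev e)"
        and g: "\<And>e. e \<in> E' \<Longrightarrow> g (snd e) \<in> window (\<chi> e) (2 ^ (K - 3 * lev e))"
        and lev_neq: "\<And>e e'. e \<in> E' \<Longrightarrow> e' \<in> E' \<Longrightarrow> e \<noteq> e' \<Longrightarrow> fst e = fst e' \<or> snd e = snd e' \<Longrightarrow> lev e \<noteq> lev e'"
        and card: "real (card E') \<ge> card E * (card (levels K) * (2 ^ K / (32 * real d ^ 2)))"
        by (rule thinning[OF assms(2,3) injA injB \<chi>_le \<chi>_le K]) (rule that, assumption+)
      have "\<not> fast_walk A B E' \<chi> vs" for vs
      proof
        assume "fast_walk A B E' \<chi> vs"
        then obtain c1 c2 c3 c4 where w: "walk A B E' 4 vs"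
          and c: "walk_coloring E' \<chi> vs = [c1, c2, c3, c4]" "c2 < c3" "c3 < c4" "c4 \<le> c1"
          unfolding fast_walk_def by blast
        from bip[OF E'] w show False
        proof (cases rule: walk_4_cases[where \<chi>=\<chi>])
          case (from_B x1 x3 y0 y2 y4)
          define s1 s2 s3 s4 where s: "s1 = lev (x1, y0)" "s2 = lev (x1, y2)" "s3 = lev (x3, y2)" "s4 = lev (x3, y4)"
          have cs: "c1 = \<chi> (x1, y0)" "c2 = \<chi> (x1, y2)" "c3 = \<chi> (x3, y2)" "c4 = \<chi> (x3, y4)"
            using c(1) from_B(6) by auto
          have "(x1, y2) \<noteq> (x1, y0)" "(x1, y2) \<noteq> (x3, y2)" "(x3, y2) \<noteq> (x3, y4)"
            using c(2-4) cs by auto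
          hence neq: "s2 \<noteq> s1" "s2 \<noteq> s3" "s3 \<noteq> s4"
            unfolding s using from_B(2-5) lev_neq by auto
          have 12: "c1 - c2 < 2 * 8 ^ s2"
            by (rule window_8_gap(3)[of "f x1" c2 s2 c1 s1])
               (use f[of "(x1, y0)"] f[of "(x1, y2)"] from_B cs s c neq in auto)
          have 34: "3 * 8 ^ s3 < 4 * (c4 - c3)"
            by (rule window_8_gap(2)[of "f x3" c3 s3 c4 s4])
               (use f[of "(x3, y2)"] f[of "(x3, y4)"] from_B cs s c neq in auto)
          have 23: "s2 < s3"
            by (rule window_2_gap(1)[of "g y2" c2 K s2 c3 s3])
               (use g[of "(x3, y2)"] g[of "(x1, y2)"] lev[of "(x1, y2)"] from_B cs s c neq in auto)
          \<comment> \<open>\<open>c1 - c2 < 2 * 8^s2 < 6 * 8^s2 \<le> 3/4 * 8^s3 < c4 - c3\<close>,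
            against \<open>c4 \<le> c1\<close> and \<open>c2 < c3\<close>.\<close>
          have "(8::nat) ^ Suc s2 \<le> 8 ^ s3" using 23 by (intro power_increasing) auto
          thus False using 12 34 c by auto
        next
          case (from_A x0 x2 x4 y1 y3)
          define s1 s2 s3 where s: "s1 = lev (x0, y1)" "s2 = lev (x2, y1)" "s3 = lev (x2, y3)"
          have cs: "c1 = \<chi> (x0, y1)" "c2 = \<chi> (x2, y1)" "c3 = \<chi> (x2, y3)"
            using c(1) from_A(6) by auto
          have "(x2, y1) \<noteq> (x0, y1)" "(x2, y1) \<noteq> (x2, y3)"
            using c(2-4) cs by auto
          hence neq: "s2 \<noteq> s1" "s2 \<noteq> s3"
            unfolding s using from_A(2-4) lev_neq by auto
          have 12: "c1 - c2 < 2 * 2 ^ (K - 3 * s2)"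
            by (rule window_2_gap(2)[of "g y1" c2 K s2 c1 s1])
               (use g[of "(x0, y1)"] g[of "(x2, y1)"] lev[of "(x2, y1)"] from_A cs s c neq in auto)
          have "f x2 \<in> window c2 (8 ^ s2)" "f x2 \<in> window c3 (8 ^ s3)"
            using f[of "(x2, y1)"] f[of "(x2, y3)"] from_A cs s by auto
          note 23 = window_8_gap(1,2)[OF this c(2) neq(2)]
          \<comment> \<open>The level bound is applied to \<open>s3\<close>, not to
            \<open>s2\<close>: with \<open>s3 < s2\<close> it gives
            \<open>K + 5 \<le> 6 * s2\<close>, hence \<open>4 * 2^(K - 3 * s2) \<le> 8^s2\<close>.
            Then \<open>c1 - c2 < 8^s2 / 2 < 3/4 * 8^s2 < c3 - c2\<close>, against
            \<open>c3 < c4 \<le> c1\<close>.\<close>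
          have "K - 3 * s2 + 2 \<le> 3 * s2"
            using lev[of "(x2, y3)"] 23(1) from_A s by (auto simp: levels_def)
          hence "(2::nat) ^ (K - 3 * s2 + 2) \<le> 2 ^ (3 * s2)" by (intro power_increasing) auto
          hence "(4::nat) * 2 ^ (K - 3 * s2) \<le> 8 ^ s2" by (simp add: power_add power_mult)
          thus False using 12 23(2) c by auto
        qed
      qed
      thus ?thesis using E' bound[OF card] by blast
    qed
    ultimately show ?thesis by blast
  qed
qed

end
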